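(* Let $n,k,r$ be integers with $r\ge 2$, $k\ge 1$ and $n\ge rk$, and let $\mathcal{P}=\{P_1,\dots,P_l\}$ be a partition of $[n]=\{1,\dots,n\}$ such that $|P_i|\le r$ for all $1\le i\le l$. Then $$\chi(\mathrm{KG}^r(n,k,\mathcal{P}))=\left\lceil \frac{n-r(k-1)}{r-1}\right\rceil .$$
   Context: For a partition $\mathcal{P}=\{P_1,\dots,P_l\}$ of $[n]$, $\mathrm{KG}^r(n,k,\mathcal{P})$ is the $r$-uniform hypergraph whose vertices are the $k$-subsets $A\subseteq[n]$ with $|A\cap P_j|\le 1$ for all $j=1,\dots,l$, and whose edges are the $r$-element sets $\{A_1,\dots,A_r\}$ of vertices that are pairwise disjoint. The chromatic number $\chi$ of a hypergraph is the least number of colors in a coloring of the vertices with no monochromatic edge. *)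

theory Defs
  imports Complex_Main "HOL-Library.Disjoint_Sets"
begin

definition kg_vertices :: "nat \<Rightarrow> nat \<Rightarrow> nat set set \<Rightarrow> nat set set" where
  "kg_vertices n k P = {A. A \<subseteq> {1..n} \<and> card A = k \<and> (\<forall>B\<in>P. card (A \<inter> B) \<le> 1)}"

definition kg_edges :: "nat \<Rightarrow> nat \<Rightarrow> nat \<Rightarrow> nat set set \<Rightarrow> nat set set set" where
  "kg_edges r n k P = {E. E \<subseteq> kg_vertices n k P \<and> card E = r \<and>
      (\<forall>A\<in>E. \<forall>A'\<in>E. A \<noteq> A' \<longrightarrow> A \<inter> A' = {})}"

definition proper_colouring :: "'v set \<Rightarrow> 'v set set \<Rightarrow> nat \<Rightarrow> ('v \<Rightarrow> nat) \<Rightarrow> bool" where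
  "proper_colouring V E c f \<longleftrightarrow> (\<forall>v\<in>V. f v < c) \<and> (\<forall>e\<in>E. \<not> (\<exists>col. \<forall>v\<in>e. f v = col))"

definition chromatic_number :: "'v set \<Rightarrow> 'v set set \<Rightarrow> nat" where
  "chromatic_number V E = (LEAST c. \<exists>f. proper_colouring V E c f)"

end

(*
  Upper bound: colour A by its minimum, r - 1 consecutive minima sharing a colour, and give the last
  colour to all remaining sets; r disjoint sets have r distinct minima, and the sets of the last
  colour live on fewer than r * k points.

  Lower bound for r = p prime: the signed sets (nonempty partial maps from [n] to Z_p) carry a free
  Z_p-action, and every equivariant sign map on them admits a full flag x_1 < ... < x_n in which
  consecutive signs differ (a Fan-type lemma). It holds because the fundamental chain
  of the flag complex, built from the minimal resolution of Z_p, pairs to 1 mod p with a normalised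
  (n - 1)-cocycle of Z_p, which vanishes on sign sequences having two equal neighbours. From a colouring
  with t colours one reads off a sign and a level, such that along a flag with changing signs the level strictly
  increases. The level records the pairs (block, sign) met by x while there are at most
  p * (k - 1) of them, and afterwards the pairs (colour, sign) realised by a transversal k-set inside a sign
  class. A colour realised with all p signs is a monochromatic edge, so the
  level is at most p * (k - 1) + (p - 1) * t, which bounds n.

  Composite r = r1 * r2: split each block into at most r1 parts of size at most r2, and colour a
  transversal k'-set W of the refinement, k' = r1 * (k - 1) + (r1 - 1) * t + 1, by the colour of a
  monochromatic r1-family inside W (Alon, Frankl and Lovasz).
*)
theory Submission
  imports Defs "HOL-Number_Theory.Number_Theory"
begin


section \<open>Coboundaries and the prism homotopy for cochains on lists\<close>

fun cobd :: "('a list \<Rightarrow> int) \<Rightarrow> 'a list \<Rightarrow> int" where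
  "cobd f [] = 0"
| "cobd f (x # xs) = f xs - cobd (\<lambda>l. f (x # l)) xs"

text \<open>The dual of filling a chain \<open>x\<^sub>0 < \<dots> < x\<^sub>m\<close> by the chains
  \<open>x\<^sub>0 < \<dots> < x\<^sub>i < T x\<^sub>i < \<dots> < T x\<^sub>m\<close> with alternating signs. The argument \<open>a\<close> stands
  for the predecessor of \<open>x\<^sub>0\<close>; it occurs only as \<open>T a\<close>. Starting with \<open>a = {}\<close> and \<open>T = insert q\<close> one gets
  the homotopy to \<open>T\<close> followed by the cone with apex \<open>{q}\<close>.\<close>

fun prism :: "('a \<Rightarrow> 'a) \<Rightarrow> ('a list \<Rightarrow> int) \<Rightarrow> 'a \<Rightarrow> 'a list \<Rightarrow> int" where
  "prism T f a [] = f [T a]"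
| "prism T f a (x # xs) = f (T a # T x # map T xs) - prism T (\<lambda>l. f (x # l)) x xs"

lemma cobd_diff: "cobd (\<lambda>l. f l - g l) l = cobd f l - cobd g l"
  by (induction l arbitrary: f g) auto

lemma cobd_mult: "cobd (\<lambda>l. c * f l) l = c * cobd f l"
  by (induction l arbitrary: f) (auto simp: algebra_simps)

lemma cobd_sum: "cobd (\<lambda>l. \<Sum>j\<in>S. f j l) l = (\<Sum>j\<in>S. cobd (f j) l)"
  by (induction l arbitrary: f) (auto simp: sum_subtractf)

lemma cobd_map: "cobd (\<lambda>l. f (map h l)) l = cobd f (map h l)"
  by (induction l arbitrary: f) auto

lemma prism_diff: "prism T (\<lambda>l. f l - g l) a l = prism T f a l - prism T g a l"
  by (induction l arbitrary: f g a) auto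

text \<open>The start enters only the leading summand. This reconciles the two starts
  \<open>a\<close> and \<open>x\<close> that meet in the induction for
  \<open>prism_cobd\<close>.\<close>

lemma prism_change_start:
  "prism T f a l - f (T a # map T l) = prism T f b l - f (T b # map T l)"
  by (cases l) auto

text \<open>Dual of a contracting homotopy: the prism joins \<open>l\<close> to
  \<open>map T l\<close>, the cone with apex \<open>T a\<close> fills \<open>map T l\<close>, and
  the two contributions of \<open>map T l\<close> cancel.\<close>

lemma prism_cobd: "prism T (cobd f) a l = f l - cobd (prism T f a) l"
proof (induction l arbitrary: f a)
  case (Cons x xs)
  have "prism T (\<lambda>l. cobd f (x # l)) x xs = prism T f x xs - prism T (cobd (\<lambda>l. f (x # l))) x xs"
    by (simp add: prism_diff)
  also have "\<dots> = prism T f x xs - f (x # xs) + cobd (prism T (\<lambda>l. f (x # l)) x) xs"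
    by (simp add: Cons.IH)
  finally show ?case
    using prism_change_start[of T f x xs a]
    by (simp add: cobd_diff cobd_map[where f = "\<lambda>l. f (T a # T x # l)"])
qed simp

section \<open>The rotation action, the resolution of the cyclic group, and the fundamental
  chain\<close>

text \<open>The identity outside \<open>{..<p}\<close>, so that its \<open>p\<close>-th power is the identity everywhere.\<close>

definition cyc :: "nat \<Rightarrow> nat \<Rightarrow> nat" where
  "cyc p i = (if i < p then Suc i mod p else i)"

definition rot :: "nat \<Rightarrow> ('a \<times> nat) set \<Rightarrow> ('a \<times> nat) set" where
  "rot p x = apsnd (cyc p) ` x"

lemma cyc_funpow: "(cyc p ^^ j) i = (if i < p then (i + j) mod p else i)"
  by (induction j) (auto simp: cyc_def mod_Suc_eq)

lemma rot_funpow: "(rot p ^^ j) x = apsnd (cyc p ^^ j) ` x"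
  by (induction j) (force simp: rot_def)+

lemma rot_funpow_order: "(rot p ^^ p) x = x"
proof -
  have "apsnd (cyc p ^^ p) = (id :: 'a \<times> nat \<Rightarrow> _)"
    by (auto simp: fun_eq_iff cyc_funpow)
  then show ?thesis by (simp add: rot_funpow)
qed

text \<open>The differentials of the minimal resolution of the cyclic group: \<open>g - 1\<close> and the
  norm \<open>1 + g + \<dots> + g\<^sup>p\<^sup>-\<^sup>1\<close> alternate.\<close>

definition trans_op :: "nat \<Rightarrow> nat \<Rightarrow> (('a \<times> nat) set list \<Rightarrow> int) \<Rightarrow> ('a \<times> nat) set list \<Rightarrow> int" where
  "trans_op p m f l = (if even m then f (map (rot p) l) - f l else \<Sum>j<p. f (map (rot p ^^ j) l))"

lemma trans_op_diff: "trans_op p m (\<lambda>l. f l - g l) l = trans_op p m f l - trans_op p m g l"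
  by (simp add: trans_op_def sum_subtractf)

lemma trans_op_cobd: "trans_op p m (cobd f) l = cobd (trans_op p m f) l"
proof -
  have eq: "trans_op p m f = (if even m then (\<lambda>l. f (map (rot p) l) - f l)
      else (\<lambda>l. \<Sum>j<p. f (map (rot p ^^ j) l)))"
    by (auto simp: trans_op_def fun_eq_iff)
  show ?thesis
    unfolding eq by (simp add: trans_op_def cobd_diff cobd_sum cobd_map)
qed

text \<open>Composing \<open>g - 1\<close> with the norm, in either order, telescopes around an
  orbit that closes up because the \<open>p\<close>-th power of \<open>rot p\<close> is the
  identity.\<close>

lemma trans_op_trans_op: "trans_op p m (trans_op p (Suc m) f) l = 0"
proof -
  have *: "(\<Sum>j<p. g (Suc j)) = (\<Sum>j<p. g j)" if "g p = g 0" for g :: "nat \<Rightarrow> int"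
  proof -
    have "(\<Sum>j<p. g (Suc j)) - (\<Sum>j<p. g j) = g p - g 0"
      by (simp add: sum_subtractf[symmetric] sum_lessThan_telescope)
    then show ?thesis using that by simp
  qed
  have per: "f (map (rot p ^^ p) l) = f (map (rot p ^^ 0) l)"
    by (simp add: rot_funpow_order[abs_def])
  show ?thesis
    using *[of "\<lambda>j. f (map (rot p ^^ j) l)", OF per]
    by (simp add: trans_op_def sum_subtractf funpow_Suc_right[symmetric] funpow.simps(2)[symmetric]
        del: funpow.simps(2))
qed

text \<open>Evaluation of an \<open>m\<close>-cochain at a chain \<open>c\<^sub>m\<close>, where the boundary of \<open>c\<^sub>m\<close> is the resolution
  differential applied to \<open>c\<^sub>m\<^sub>-\<^sub>1\<close>.\<close>

fun fundamental :: "nat \<Rightarrow> nat \<Rightarrow> ((nat \<times> nat) set list \<Rightarrow> int) \<Rightarrow> int" where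
  "fundamental p 0 f = f [{(0, 0)}]"
| "fundamental p (Suc m) f =
     fundamental p m (trans_op p m (prism (insert (Suc m, 0)) f {}))"

lemma fundamental_diff:
  "fundamental p m (\<lambda>l. f l - g l) = fundamental p m f - fundamental p m g"
proof (induction m arbitrary: f g)
  case (Suc m)
  show ?case
    by (simp add: prism_diff[abs_def] trans_op_diff[abs_def] Suc)
qed simp

lemma fundamental_zero: "fundamental p m (\<lambda>l. 0) = 0"
  using fundamental_diff[of p m "\<lambda>_. 0" "\<lambda>_. 0"] by simp

text \<open>Dual of the boundary formula for the fundamental chain. \<open>prism_cobd\<close> leaves
  one correction term, to which the induction hypothesis applies a second differential, so it
  vanishes.\<close>

lemma fundamental_cobd: "fundamental p (Suc m) (cobd f) = fundamental p m (trans_op p m f)"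
proof (induction m arbitrary: f)
  case 0
  show ?case by (simp add: trans_op_def prism_cobd)
next
  case (Suc m)
  let ?T = "insert (Suc (Suc m), 0)" and ?D = "trans_op p (Suc m)"
  have "fundamental p (Suc (Suc m)) (cobd f) =
      fundamental p (Suc m) (\<lambda>l. ?D f l - cobd (?D (prism ?T f {})) l)"
    by (simp only: fundamental.simps prism_cobd[abs_def] trans_op_diff[abs_def] trans_op_cobd)
  also have "\<dots> = fundamental p (Suc m) (?D f) -
      fundamental p m (trans_op p m (?D (prism ?T f {})))"
    by (simp only: fundamental_diff Suc.IH)
  also have "trans_op p m (?D (prism ?T f {})) = (\<lambda>l. 0)"
    by (simp add: fun_eq_iff trans_op_trans_op)
  finally show ?case by (simp add: fundamental_zero)
qed

section \<open>Flags of signed sets as the support of the fundamental chain\<close>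

definition signed_sets :: "nat \<Rightarrow> nat \<Rightarrow> (nat \<times> nat) set set" where
  "signed_sets p n = {x. x \<noteq> {} \<and> x \<subseteq> {..<n} \<times> {..<p} \<and> inj_on fst x}"

definition flags :: "nat \<Rightarrow> nat \<Rightarrow> (nat \<times> nat) set list set" where
  "flags p n = {l. length l = n \<and> sorted_wrt (\<subset>) l \<and> set l \<subseteq> signed_sets p n}"

text \<open>Inserting a fresh \<open>q\<close> preserves strict inclusions and enlarges each set, so
  \<open>f\<close> is only evaluated at strict chains.\<close>

lemma prism_dvd:
  assumes "\<And>l'. length l' = Suc (length l) \<Longrightarrow> sorted_wrt (\<subset>) l' \<Longrightarrow>
      set l' \<subseteq> set l \<union> insert q ` insert a (set l) \<Longrightarrow> c dvd f l'"
    and "sorted_wrt (\<subset>) (a # l)" and "\<And>x. x \<in> insert a (set l) \<Longrightarrow> q \<notin> x"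
  shows "c dvd prism (insert q) f a l"
  using assms
proof (induction l arbitrary: f a)
  case (Cons x xs)
  have "c dvd f (map (insert q) (a # x # xs))"
  proof (rule Cons.prems(1))
    show "sorted_wrt (\<subset>) (map (insert q) (a # x # xs))"
      unfolding sorted_wrt_map
    proof (rule sorted_wrt_mono_rel[OF _ Cons.prems(2)])
      fix y z assume "y \<in> set (a # x # xs)" "z \<in> set (a # x # xs)" "y \<subset> z"
      then show "insert q y \<subset> insert q z"
        using Cons.prems(3)[of y] Cons.prems(3)[of z] by auto
    qed
  qed auto
  moreover have "c dvd prism (insert q) (\<lambda>l. f (x # l)) x xs"
  proof (rule Cons.IH)
    fix l' assume l': "length l' = Suc (length xs)" "sorted_wrt (\<subset>) l'"
      "set l' \<subseteq> set xs \<union> insert q ` insert x (set xs)"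
    have "x \<subset> y" if "y \<in> set l'" for y
    proof -
      have "y \<in> set xs \<or> (\<exists>z\<in>insert x (set xs). y = insert q z)" using that l'(3) by auto
      moreover have "\<And>z. z \<in> set xs \<Longrightarrow> x \<subset> z" using Cons.prems(2) by auto
      moreover have "q \<notin> x" using Cons.prems(3) by auto
      ultimately show ?thesis by blast
    qed
    then show "c dvd f (x # l')"
      using l' by (intro Cons.prems(1)) auto
  qed (use Cons.prems in auto)
  ultimately show ?case by (simp add: dvd_diff)
qed auto

lemma rot_in_signed_sets:
  assumes "x \<in> signed_sets p n" shows "rot p x \<in> signed_sets p n"
proof -
  have x: "x \<noteq> {}" "x \<subseteq> {..<n} \<times> {..<p}" "inj_on fst x"
    using assms by (auto simp: signed_sets_def)
  have "inj_on fst (rot p x)"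
  proof (rule inj_onI)
    fix y z assume "y \<in> rot p x" "z \<in> rot p x" and eq: "fst y = fst z"
    then obtain y' z' where "y' \<in> x" "z' \<in> x" "y = apsnd (cyc p) y'" "z = apsnd (cyc p) z'"
      by (auto simp: rot_def)
    with eq x(3) show "y = z" by (auto dest: inj_onD)
  qed
  moreover have "rot p x \<subseteq> {..<n} \<times> {..<p}"
    using x(2) by (fastforce simp: rot_def cyc_def)
  ultimately show ?thesis using x(1) by (simp add: signed_sets_def) (simp add: rot_def)
qed

lemma rot_inject: "rot p x = rot p y \<longleftrightarrow> x = y"
proof
  assume eq: "rot p x = rot p y"
  have "(rot p ^^ p) x = (rot p ^^ p) y"
  proof (cases p)
    case 0
    have "cyc 0 = id" by (simp add: cyc_def fun_eq_iff)
    with eq 0 show ?thesis by (simp add: rot_def)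
  next
    case (Suc q)
    then show ?thesis using eq by (simp add: funpow_Suc_right del: funpow.simps(2))
  qed
  then show "x = y" by (simp add: rot_funpow_order)
qed simp

lemma rot_psubset: "x \<subset> y \<Longrightarrow> rot p x \<subset> rot p y"
  by (metis rot_inject rot_def image_mono psubset_eq)

lemma map_rot_in_flags:
  assumes "l \<in> flags p n" shows "map (rot p) l \<in> flags p n"
proof -
  have "sorted_wrt (\<subset>) (map (rot p) l)"
    unfolding sorted_wrt_map
    by (rule sorted_wrt_mono_rel[of l "(\<subset>)"]) (use assms in \<open>auto simp: flags_def rot_psubset\<close>)
  then show ?thesis using assms by (auto simp: flags_def rot_in_signed_sets)
qed

lemma map_rot_funpow_in_flags: "l \<in> flags p n \<Longrightarrow> map (rot p ^^ j) l \<in> flags p n"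
proof (induction j)
  case (Suc j)
  then show ?case using map_rot_in_flags[of "map (rot p ^^ j) l" p n] by (simp add: comp_def)
qed simp

text \<open>The fundamental chain is supported on flags: the apex \<open>(Suc m, 0)\<close> uses a
  new point, and rotation preserves flags. Divisibility covers both vanishing and, through
  differences, congruence modulo \<open>c\<close>.\<close>

lemma fundamental_dvd:
  assumes "p > 0" and "\<And>l. l \<in> flags p (Suc m) \<Longrightarrow> c dvd f l"
  shows "c dvd fundamental p m f"
  using assms(2)
proof (induction m arbitrary: f)
  case 0
  then show ?case using assms(1) by (auto simp: flags_def signed_sets_def)
next
  case (Suc m)
  have prism: "c dvd prism (insert (Suc m, 0)) f {} l" if l: "l \<in> flags p (Suc m)" for l
  proof (rule prism_dvd)
    have sub: "\<And>x. x \<in> set l \<Longrightarrow> x \<noteq> {} \<and> x \<subseteq> {..<Suc m} \<times> {..<p} \<and> inj_on fst x"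
      using l by (auto simp: flags_def signed_sets_def)
    then show "sorted_wrt (\<subset>) ({} # l)" using l by (auto simp: flags_def)
    show "(Suc m, 0) \<notin> x" if "x \<in> insert {} (set l)" for x
      using that sub[of x] by auto
    fix l' assume l': "length l' = Suc (length l)" "sorted_wrt (\<subset>) l'"
      "set l' \<subseteq> set l \<union> insert (Suc m, 0) ` insert {} (set l)"
    have "y \<in> signed_sets p (Suc (Suc m))" if "y \<in> set l'" for y
    proof -
      have "y \<in> set l \<or> (\<exists>z\<in>insert {} (set l). y = insert (Suc m, 0) z)"
        using that l'(3) by auto
      then show ?thesis
      proof
        assume "y \<in> set l"
        then show ?thesis using sub[of y] by (auto simp: signed_sets_def)
      next
        assume "\<exists>z\<in>insert {} (set l). y = insert (Suc m, 0) z"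
        then obtain z where z: "z = {} \<or> z \<in> set l" "y = insert (Suc m, 0) z" by auto
        have "z \<subseteq> {..<Suc m} \<times> {..<p} \<and> inj_on fst z" using z(1) sub[of z] by auto
        then show ?thesis using z(2) assms(1) by (auto simp: signed_sets_def)
      qed
    qed
    then show "c dvd f l'" using l l' by (intro Suc.prems) (auto simp: flags_def)
  qed
  show ?case
    unfolding fundamental.simps
  proof (rule Suc.IH)
    fix l assume "l \<in> flags p (Suc m)"
    then show "c dvd trans_op p m (prism (insert (Suc m, 0)) f {}) l"
      unfolding trans_op_def
      by (auto intro!: dvd_diff dvd_sum prism map_rot_in_flags map_rot_funpow_in_flags)
  qed
qed

lemma fundamental_cong:
  assumes "p > 0" and "\<And>l. l \<in> flags p (Suc m) \<Longrightarrow> [f l = g l] (mod c)"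
  shows "[fundamental p m f = fundamental p m g] (mod c)"
  using fundamental_dvd[of p m c "\<lambda>l. f l - g l"] assms
  by (simp add: cong_iff_dvd_diff fundamental_diff)


section \<open>Normalised cocycles of the cyclic group in every degree\<close>

text \<open>The cocycle of the extension of \<open>\<int>/p\<close> by \<open>\<int>\<close>. Cup products of it with itself and with
  \<open>t - s\<close> give a cocycle in each degree; \<open>resol_potential\<close> is a non-invariant primitive of the next one.\<close>

definition carry :: "nat \<Rightarrow> nat \<Rightarrow> nat \<Rightarrow> int" where
  "carry s t u = of_bool (u < t) - of_bool (u < s) + of_bool (t < s)"

fun resol_cocycle :: "nat list \<Rightarrow> int" where
  "resol_cocycle [] = 0"
| "resol_cocycle [s] = 1"
| "resol_cocycle [s, t] = int t - int s"
| "resol_cocycle (s # t # u # l) = carry s t u * resol_cocycle (u # l)"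

fun resol_potential :: "nat list \<Rightarrow> int" where
  "resol_potential [] = 0"
| "resol_potential [s] = int s"
| "resol_potential [s, t] = of_bool (t < s)"
| "resol_potential (s # t # u # l) = carry s t u * resol_potential (u # l)"

text \<open>\<open>carry\<close> is itself the coboundary of the function sending \<open>s\<close>,
  \<open>t\<close> to \<open>of_bool (t < s)\<close>.\<close>

lemma carry_cocycle: "carry t u v - carry s u v + carry s t v - carry s t u = 0"
  by (simp add: carry_def)

text \<open>Leibniz rule: the factor \<open>carry\<close> is a cocycle, so the coboundary acts on
  the tail alone. Singletons are excluded because there the coboundary is
  \<open>resol_potential [] = 0\<close>, not 1.\<close>

lemma cobd_resol_potential:
  "length l \<ge> 2 \<Longrightarrow> cobd resol_potential l = resol_cocycle l"
proof (induction l rule: resol_cocycle.induct)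
  case (4 s t u l)
  show ?case
  proof (cases l)
    case (Cons v l')
    let ?f = resol_potential
    have IH: "?f (v # l') - cobd (\<lambda>l. ?f (u # l)) (v # l') = resol_cocycle (u # l)"
      using 4 Cons by simp
    have "cobd ?f (s # t # u # l) = (carry t u v - carry s u v + carry s t v) * ?f (v # l')
        - carry s t u * cobd (\<lambda>l. ?f (u # l)) (v # l')"
      unfolding Cons by (simp add: cobd_diff cobd_mult algebra_simps)
    also have "\<dots> = carry s t u * (?f (v # l') - cobd (\<lambda>l. ?f (u # l)) (v # l'))"
      using carry_cocycle[of t u v s] by (simp add: algebra_simps)
    finally show ?thesis using IH by simp
  qed (simp add: carry_def)
qed auto

text \<open>The cocycle is normalised: \<open>carry\<close> vanishes if its first two or its last
  two arguments agree, and \<open>t - s\<close> vanishes for \<open>s = t\<close>.\<close>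

lemma resol_cocycle_distinct_adj: "resol_cocycle l \<noteq> 0 \<Longrightarrow> distinct_adj l"
  by (induction l rule: resol_cocycle.induct) (auto simp: carry_def)

text \<open>Multiplied by \<open>p\<close>, \<open>carry\<close> is an alternating sum of residues
  of differences, and these ignore a common shift.\<close>

lemma carry_shift:
  assumes "s < p" "t < p" "u < p"
  shows "carry ((s + j) mod p) ((t + j) mod p) ((u + j) mod p) = carry s t u"
proof -
  have *: "int p * of_bool (y < x) = int x - int y + int (((y + (p - x)) mod p))"
    if "x < p" "y < p" for x y
    using that by (cases "y < x") (auto simp: mod_if)
  have d: "((y + j) mod p + (p - (x + j) mod p)) mod p = (y + (p - x)) mod p"
    if "x < p" "y < p" for x y
  proof -
    have "p > 0" using that by simp
    then have "(x + j) mod p \<le> p" by (simp add: less_imp_le)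
    then have "int (((y + j) mod p + (p - (x + j) mod p)) mod p)
        = (int ((y + j) mod p) + (int p - int ((x + j) mod p))) mod int p"
      by (simp add: zmod_int of_nat_diff add_diff_eq)
    also have "\<dots> = (int y - int x) mod int p"
    proof -
      have "[int ((y + j) mod p) + (int p - int ((x + j) mod p)) =
         int (y + j) + (0 - int (x + j))] (mod int p)"
        by (intro cong_add cong_diff) (auto simp: zmod_int cong_def)
      then show ?thesis by (simp add: cong_def)
    qed
    also have "\<dots> = int ((y + (p - x)) mod p)"
      using that by (simp add: zmod_int of_nat_diff) (metis add_diff_eq add.commute mod_add_self2 diff_add_eq)
    finally show ?thesis by simp
  qed
  have eq: "int p * carry s t u = int ((u + (p - t)) mod p) - int ((u + (p - s)) mod p) + int ((t + (p - s)) mod p)"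
    if "s < p" "t < p" "u < p" for s t u
    unfolding carry_def using *[of t u] *[of s u] *[of s t] that by (simp add: algebra_simps)
  have lt: "(x + j) mod p < p" for x using assms(1) by simp
  have "int p * carry ((s + j) mod p) ((t + j) mod p) ((u + j) mod p) = int p * carry s t u"
    unfolding eq[OF lt lt lt] eq[OF assms] by (simp only: d assms)
  then show ?thesis using assms by simp
qed

text \<open>The residue of \<open>t + j\<close> is that of \<open>s + j\<close> plus a constant
  \<open>?d\<close>, minus \<open>p\<close> on each wrap-around. Over a full period both residues
  have the same sum, so there are exactly \<open>?d\<close> wraps.\<close>

lemma sum_carry:
  assumes "s < p" "t < p"
  shows "[(\<Sum>j<p. of_bool ((t + j) mod p < (s + j) mod p)) = int t - int s] (mod int p)"
proof -
  let ?d = "(t + (p - s)) mod p"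
  have perm: "(\<Sum>j<p. int ((x + j) mod p)) = (\<Sum>j<p. int (j mod p))" for x
  proof (induction x)
    case (Suc x)
    have "(\<Sum>j<p. int ((Suc x + j) mod p)) - (\<Sum>j<p. int ((x + j) mod p)) =
        int ((x + p) mod p) - int ((x + 0) mod p)"
      using sum_lessThan_telescope[of "\<lambda>j. int ((x + j) mod p)" p]
      by (simp add: sum_subtractf del: of_nat_mod)
    then show ?case using Suc by simp
  qed simp
  have step: "int ((t + j) mod p) = int ((s + j) mod p) + int ?d -
      int p * of_bool ((t + j) mod p < (s + j) mod p)" for j
  proof -
    let ?x = "(s + j) mod p" and ?y = "(t + j) mod p"
    have "(?x + ?d) mod p = ((s + j) + (t + (p - s))) mod p" by (simp add: mod_simps)
    also have "(s + j) + (t + (p - s)) = (t + j) + p" using assms by simp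
    finally have "(?x + ?d) mod p = ?y" by simp
    moreover have "?x < p" "?d < p" using assms by simp_all
    ultimately show ?thesis by (cases "?x + ?d < p") (auto simp: mod_if[of "?x + ?d"] simp del: of_nat_mod)
  qed
  have "(\<Sum>j<p. int ((t + j) mod p)) = (\<Sum>j<p. int ((s + j) mod p) + int ?d -
      int p * of_bool ((t + j) mod p < (s + j) mod p))"
    by (intro sum.cong step refl)
  also have "\<dots> = (\<Sum>j<p. int ((s + j) mod p)) + int p * int ?d
      - int p * (\<Sum>j<p. of_bool ((t + j) mod p < (s + j) mod p))"
    by (simp only: sum.distrib sum_subtractf sum_distrib_left) simp
  finally have "int p * (\<Sum>j<p. of_bool ((t + j) mod p < (s + j) mod p)) = int p * int ?d"
    unfolding perm by linarith
  then have "(\<Sum>j<p. of_bool ((t + j) mod p < (s + j) mod p)) = int ?d"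
    using assms by simp
  moreover have "[int ?d = int t - int s] (mod int p)"
  proof -
    have "int ?d = (int t + (int p - int s)) mod int p"
      using assms by (simp add: zmod_int of_nat_diff add_diff_eq)
    also have "\<dots> = (int t - int s + int p) mod int p" by (simp add: algebra_simps)
    finally show ?thesis by (simp add: cong_def)
  qed
  ultimately show ?thesis by simp
qed

text \<open>Shift invariance of \<open>carry\<close> strips entries in pairs down to a singleton,
  where a rotation adds one modulo \<open>p\<close>.\<close>

lemma resol_potential_trans:
  assumes "set l \<subseteq> {..<p}" and "odd (length l)"
  shows "[resol_potential (map (\<lambda>s. Suc s mod p) l) - resol_potential l = resol_cocycle l] (mod int p)"
  using assms
proof (induction l rule: resol_cocycle.induct)
  case (2 s)
  have "[int (Suc s mod p) = int (Suc s)] (mod int p)" by (simp add: cong_def zmod_int)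
  then have "[int (Suc s mod p) - int s = int (Suc s) - int s] (mod int p)"
    by (intro cong_diff) auto
  then show ?case by simp
next
  case (4 s t u l)
  have "carry (Suc s mod p) (Suc t mod p) (Suc u mod p) = carry s t u"
    using carry_shift[of s p t u 1] 4(2) by simp
  then have "resol_potential (map (\<lambda>s. Suc s mod p) (s # t # u # l)) - resol_potential (s # t # u # l)
     = carry s t u * (resol_potential (map (\<lambda>s. Suc s mod p) (u # l)) - resol_potential (u # l))"
    by (simp add: algebra_simps)
  then show ?case using 4 by (auto intro!: cong_scalar_left simp del: list.map)
qed auto

text \<open>The same reduction ends at a pair, where \<open>sum_carry\<close> counts the
  wraps.\<close>

lemma resol_potential_norm:
  assumes "set l \<subseteq> {..<p}" and "even (length l)"
  shows "[(\<Sum>j<p. resol_potential (map (\<lambda>s. (s + j) mod p) l)) = resol_cocycle l] (mod int p)"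
  using assms
proof (induction l rule: resol_cocycle.induct)
  case (3 s t)
  then show ?case using sum_carry[of s p t] by simp
next
  case (4 s t u l)
  have "(\<Sum>j<p. resol_potential (map (\<lambda>s. (s + j) mod p) (s # t # u # l)))
     = (\<Sum>j<p. carry s t u * resol_potential (map (\<lambda>s. (s + j) mod p) (u # l)))"
    using 4(2) by (intro sum.cong) (simp_all add: carry_shift)
  also have "\<dots> = carry s t u * (\<Sum>j<p. resol_potential (map (\<lambda>s. (s + j) mod p) (u # l)))"
    by (simp only: sum_distrib_left)
  finally show ?case using 4 by (auto intro!: cong_scalar_left simp del: list.map)
qed auto

section \<open>The Fan-type lemma for equivariant sign maps\<close>

lemma equivariant_sign_funpow:
  assumes "\<And>x. x \<in> signed_sets p n \<Longrightarrow> s x < p \<and> s (rot p x) = Suc (s x) mod p"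
    and "x \<in> signed_sets p n"
  shows "(rot p ^^ j) x \<in> signed_sets p n \<and> s ((rot p ^^ j) x) = (s x + j) mod p"
proof (induction j)
  case 0
  then show ?case using assms by auto
next
  case (Suc j)
  then show ?case using assms(1)[of "(rot p ^^ j) x"] rot_in_signed_sets[of "(rot p ^^ j) x" p n]
    by (simp add: mod_Suc_eq)
qed

text \<open>The cocycle is the coboundary of the potential; moving the coboundary onto the chain
  turns it into the resolution differential, which maps the potential to the cocycle one degree
  lower. In degree 0 the value is 1.\<close>

lemma fundamental_resol_cocycle:
  assumes p: "p > 0"
    and s: "\<And>x. x \<in> signed_sets p (Suc m) \<Longrightarrow> s x < p \<and> s (rot p x) = Suc (s x) mod p"
  shows "[fundamental p m (\<lambda>l. resol_cocycle (map s l)) = 1] (mod int p)"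
  using s
proof (induction m)
  case (Suc m)
  let ?e = "\<lambda>l. resol_cocycle (map s l)" and ?f = "\<lambda>l. resol_potential (map s l)"
  have sub: "x \<in> signed_sets p (Suc (Suc m))" if "x \<in> signed_sets p (Suc m)" for x
    using that by (auto simp: signed_sets_def)
  note s = Suc.prems[OF sub]
  have "[fundamental p (Suc m) ?e = fundamental p (Suc m) (cobd ?f)] (mod int p)"
    using p by (rule fundamental_cong) (simp add: cobd_map cobd_resol_potential flags_def)
  also have "fundamental p (Suc m) (cobd ?f) = fundamental p m (trans_op p m ?f)"
    by (rule fundamental_cobd)
  also have "[\<dots> = fundamental p m ?e] (mod int p)"
  proof (rule fundamental_cong[OF p])
    fix l assume l: "l \<in> flags p (Suc m)"
    have len: "length l = Suc m" using l by (simp add: flags_def)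
    have mem: "x \<in> signed_sets p (Suc m)" if "x \<in> set l" for x
      using l that by (auto simp: flags_def)
    have small: "set (map s l) \<subseteq> {..<p}" using s mem by auto
    show "[trans_op p m ?f l = ?e l] (mod int p)"
    proof (cases "even m")
      case True
      have "map s (map (rot p) l) = map (\<lambda>i. Suc i mod p) (map s l)" using s mem by simp
      then show ?thesis
        using resol_potential_trans[OF small] True len unfolding trans_op_def by (simp del: map_map)
    next
      case False
      have "map s (map (rot p ^^ j) l) = map (\<lambda>i. (i + j) mod p) (map s l)" for j
        using equivariant_sign_funpow[where s = s and p = p and n = "Suc m"] s mem by simp
      then show ?thesis
        using resol_potential_norm[OF small] False len unfolding trans_op_def by (simp del: map_map)
    qed
  qed
  also have "[fundamental p m ?e = 1] (mod int p)" by (rule Suc.IH) (rule s)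
  finally show ?case .
qed simp

lemma distinct_adj_flag:
  assumes "p \<ge> 2"
    and "\<And>x. x \<in> signed_sets p (Suc m) \<Longrightarrow> s x < p \<and> s (rot p x) = Suc (s x) mod p"
  shows "\<exists>l\<in>flags p (Suc m). distinct_adj (map s l)"
proof (rule ccontr)
  assume "\<not> ?thesis"
  then have "resol_cocycle (map s l) = 0" if "l \<in> flags p (Suc m)" for l
    using that resol_cocycle_distinct_adj by blast
  then have "int p dvd fundamental p m (\<lambda>l. resol_cocycle (map s l))"
    using assms(1) by (intro fundamental_dvd) auto
  moreover have "[fundamental p m (\<lambda>l. resol_cocycle (map s l)) = 1] (mod int p)"
    using assms by (intro fundamental_resol_cocycle) auto
  ultimately have "int p dvd 1" using cong_dvd_iff by fastforce
  then show False using assms(1) by simp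
qed


section \<open>Equivariant signs of sets of pairs\<close>

definition slice :: "('a \<times> nat) set \<Rightarrow> 'a \<Rightarrow> nat set" where
  "slice S j = {i. (j, i) \<in> S}"

text \<open>Among subsets of \<open>{..<p}\<close> only the empty and the full one are rotation
  invariant, so mixed slices are those that can carry a sign.\<close>

definition mixed :: "nat \<Rightarrow> ('a \<times> nat) set \<Rightarrow> 'a \<Rightarrow> bool" where
  "mixed p S j \<longleftrightarrow> slice S j \<noteq> {} \<and> slice S j \<noteq> {..<p}"

text \<open>Shifting \<open>I\<close> by one adds \<open>card I\<close> to its sum modulo \<open>p\<close>; dividing by \<open>card I\<close>, which is
  possible for prime \<open>p\<close> and \<open>0 < card I < p\<close>, makes the sign equivariant.\<close>

definition slice_sign :: "nat \<Rightarrow> nat set \<Rightarrow> nat" where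
  "slice_sign p I = ((SOME q. [q * card I = 1] (mod p)) * \<Sum>I) mod p"

text \<open>Rotation does not change which positions are mixed, so the choice of the least one is
  invariant.\<close>

definition set_sign :: "nat \<Rightarrow> (nat \<times> nat) set \<Rightarrow> nat" where
  "set_sign p S = slice_sign p (slice S (LEAST j. mixed p S j))"

lemma inj_cyc: "inj (cyc p)"
proof (rule injI)
  fix i j assume "cyc p i = cyc p j"
  then have "(cyc p ^^ p) i = (cyc p ^^ p) j"
    by (cases p) (auto simp: funpow_Suc_right cyc_def simp del: funpow.simps(2))
  then show "i = j" by (auto simp: cyc_funpow split: if_splits)
qed

lemma cyc_image_lessThan: "cyc p ` {..<p} = {..<p}"
  by (rule endo_inj_surj) (auto simp: cyc_def intro: inj_on_subset[OF inj_cyc])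

lemma slice_rot: "slice (rot p S) j = cyc p ` slice S j"
  by (force simp: slice_def rot_def)

lemma mixed_rot: "mixed p (rot p S) = mixed p S"
proof
  have "cyc p ` I = {..<p} \<longleftrightarrow> I = {..<p}" for I
    using inj_image_eq_iff[OF inj_cyc, of p I "{..<p}"] by (simp add: cyc_image_lessThan)
  then show "mixed p (rot p S) j = mixed p S j" for j by (simp add: mixed_def slice_rot)
qed

lemma slice_sign_cyc:
  assumes "prime p" and "I \<subseteq> {..<p}" "I \<noteq> {}" "I \<noteq> {..<p}"
  shows "slice_sign p (cyc p ` I) = Suc (slice_sign p I) mod p"
proof -
  have inj: "inj_on (cyc p) I" by (rule inj_on_subset[OF inj_cyc]) simp
  have fin: "finite I" using assms(2) finite_subset by blast
  have "card I < p" using psubset_card_mono[of "{..<p}" I] assms by auto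
  moreover have "card I > 0" using fin assms(3) by (simp add: card_gt_0_iff)
  ultimately have "coprime (card I) p"
    using prime_imp_coprime[OF assms(1), of "card I"] by (auto simp: coprime_commute dest: nat_dvd_not_less)
  then obtain q where "[card I * q = 1] (mod p)" using cong_solve_coprime_nat by auto
  then have ex: "\<exists>q. [q * card I = 1] (mod p)" by (auto simp: mult.commute)
  define q where "q = (SOME q. [q * card I = 1] (mod p))"
  have q: "[q * card I = 1] (mod p)" unfolding q_def using ex by (rule someI_ex)
  have "[\<Sum>(cyc p ` I) = (\<Sum>i\<in>I. Suc i)] (mod p)"
    unfolding sum.reindex[OF inj] comp_def id_def
    using assms(2) by (intro cong_sum) (auto simp: cyc_def cong_def)
  also have "(\<Sum>i\<in>I. Suc i) = \<Sum>I + card I" by (rule sum_Suc)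
  finally have "[q * \<Sum>(cyc p ` I) = q * (\<Sum>I + card I)] (mod p)" by (rule cong_scalar_left)
  also have "q * (\<Sum>I + card I) = q * \<Sum>I + q * card I" by (simp add: distrib_left)
  also have "[\<dots> = q * \<Sum>I + 1] (mod p)" using q by (intro cong_add) auto
  finally have "(q * \<Sum>(cyc p ` I)) mod p = (Suc (q * \<Sum>I)) mod p" by (simp add: cong_def)
  moreover have "card (cyc p ` I) = card I" by (rule card_image[OF inj])
  ultimately show ?thesis by (simp only: slice_sign_def q_def[symmetric] mod_Suc_eq)
qed

lemma set_sign_rot:
  assumes "prime p" and "S \<subseteq> UNIV \<times> {..<p}" and "\<exists>j. mixed p S j"
  shows "set_sign p S < p \<and> set_sign p (rot p S) = Suc (set_sign p S) mod p"
proof -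
  define j where "j = (LEAST j. mixed p S j)"
  have "mixed p S j" unfolding j_def using assms(3) by (metis LeastI)
  then have "slice_sign p (cyc p ` slice S j) = Suc (slice_sign p (slice S j)) mod p"
    using assms(2) by (intro slice_sign_cyc assms(1)) (auto simp: mixed_def slice_def)
  moreover have "p > 0" using assms(1) by (rule prime_gt_0_nat)
  ultimately show ?thesis
    by (simp add: set_sign_def mixed_rot slice_rot j_def[symmetric] slice_sign_def)
qed

section \<open>The lower bound for prime uniformity\<close>

definition mono_family :: "nat \<Rightarrow> nat \<Rightarrow> ('a \<Rightarrow> nat) \<Rightarrow> ('a set \<Rightarrow> nat) \<Rightarrow> 'a set \<Rightarrow> (nat \<Rightarrow> 'a set) \<Rightarrow> nat \<Rightarrow> bool" where
  "mono_family r k b c V G col \<longleftrightarrow> disjoint_family_on G {..<r} \<and>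
     (\<forall>i<r. G i \<subseteq> V \<and> card (G i) = k \<and> inj_on b (G i) \<and> c (G i) = col)"

text \<open>Blocks are the fibres of \<open>b\<close>, so transversal means \<open>inj_on b\<close>.
  Ground set, blocks and colouring are arbitrary so that the composite case can pass to subsets and
  derived colourings.\<close>

definition forces_mono :: "nat \<Rightarrow> bool" where
  "forces_mono r \<longleftrightarrow> (\<forall>(V :: nat set) k b c t. finite V \<longrightarrow> 1 \<le> k \<longrightarrow>
     (\<forall>j. card {v \<in> V. b v = j} \<le> r) \<longrightarrow>
     (\<forall>A. A \<subseteq> V \<longrightarrow> card A = k \<longrightarrow> inj_on b A \<longrightarrow> c A < t) \<longrightarrow>
     r * (k - 1) + (r - 1) * t < card V \<longrightarrow> (\<exists>G col. mono_family r k b c V G col))"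

locale prime_colouring =
  fixes p k t n :: nat and b :: "nat \<Rightarrow> nat" and c :: "nat set \<Rightarrow> nat"
  assumes p: "prime p" and k: "k \<ge> 1"
    and block: "card {v \<in> {..<n}. b v = j} \<le> p"
    and colour: "A \<subseteq> {..<n} \<Longrightarrow> card A = k \<Longrightarrow> inj_on b A \<Longrightarrow> c A < t"
    and no_mono: "\<not> mono_family p k b c {..<n} G col"
begin

definition cls :: "(nat \<times> nat) set \<Rightarrow> nat \<Rightarrow> nat set" where
  "cls x i = {v. (v, i) \<in> x}"

definition types :: "(nat \<times> nat) set \<Rightarrow> (nat \<times> nat) set" where
  "types x = (\<lambda>(v, i). (b v, i)) ` x"

definition hues :: "(nat \<times> nat) set \<Rightarrow> (nat \<times> nat) set" where
  "hues x = {(c A, i) | A i. A \<subseteq> cls x i \<and> card A = k \<and> inj_on b A}"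

definition low :: "(nat \<times> nat) set \<Rightarrow> bool" where
  "low x \<longleftrightarrow> card (types x) \<le> p * (k - 1)"

text \<open>The set from which the sign of \<open>x\<close> is read off. If \<open>types x\<close> is invariant under
  rotation it carries no sign, but then \<open>x\<close> is maximal among the signed sets of its type
  (\<open>full_types_maximal\<close>), and the sign can be taken from \<open>x\<close> itself.\<close>

definition carrier_set :: "(nat \<times> nat) set \<Rightarrow> (nat \<times> nat) set" where
  "carrier_set x = (if low x then if Ex (mixed p (types x)) then types x else x else hues x)"

definition level :: "(nat \<times> nat) set \<Rightarrow> nat" where
  "level x = (if low x then card (types x) else p * (k - 1) + card (hues x))"

lemma p_pos: "p > 0" "p \<ge> 2"
  using prime_ge_2_nat[OF p] by auto

lemma signed_setD:
  assumes "x \<in> signed_sets p n"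
  shows "x \<noteq> {}" "finite x" "\<And>v i. (v, i) \<in> x \<Longrightarrow> v < n \<and> i < p"
    "\<And>v i j. (v, i) \<in> x \<Longrightarrow> (v, j) \<in> x \<Longrightarrow> i = j"
proof -
  have x: "x \<noteq> {}" "x \<subseteq> {..<n} \<times> {..<p}" "inj_on fst x"
    using assms by (auto simp: signed_sets_def)
  then show "x \<noteq> {}" "\<And>v i. (v, i) \<in> x \<Longrightarrow> v < n \<and> i < p" by auto
  show "finite x" using x(2) by (rule finite_subset) simp
  show "i = j" if "(v, i) \<in> x" "(v, j) \<in> x" for v i j
    using inj_onD[OF x(3), of "(v, i)" "(v, j)"] that by simp
qed

lemma types_mono: "x \<subseteq> y \<Longrightarrow> types x \<subseteq> types y"
  by (auto simp: types_def)

lemma hues_mono: "x \<subseteq> y \<Longrightarrow> hues x \<subseteq> hues y"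
  unfolding hues_def cls_def by blast

lemma types_rot: "types (rot p x) = rot p (types x)"
  by (force simp: types_def rot_def)

lemma cls_rot: "cls (rot p x) (cyc p i) = cls x i"
  using inj_cyc[of p] by (force simp: cls_def rot_def dest: injD)

lemma hues_rot: "hues (rot p x) = rot p (hues x)"
proof
  show "rot p (hues x) \<subseteq> hues (rot p x)"
  proof
    fix z assume "z \<in> rot p (hues x)"
    then obtain A i where "z = (c A, cyc p i)" "A \<subseteq> cls x i" "card A = k" "inj_on b A"
      by (auto simp: hues_def rot_def)
    then show "z \<in> hues (rot p x)" unfolding hues_def using cls_rot[of x i] by blast
  qed
  show "hues (rot p x) \<subseteq> rot p (hues x)"
  proof
    fix z assume "z \<in> hues (rot p x)"
    then obtain A i where A: "z = (c A, i)" "A \<subseteq> cls (rot p x) i" "card A = k" "inj_on b A"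
      by (auto simp: hues_def)
    \<comment> \<open>An empty \<open>A\<close> would lie in every class; an element of
      \<open>A\<close> shows that the sign \<open>i\<close> comes from a rotation.\<close>
    have "A \<noteq> {}" using A(3) k by auto
    then obtain v where "(v, i) \<in> rot p x" using A(2) by (auto simp: cls_def)
    then obtain i' where i': "i = cyc p i'" by (auto simp: rot_def)
    then have "(c A, i') \<in> hues x" using A by (auto simp: hues_def cls_rot)
    then show "z \<in> rot p (hues x)" using A(1) i' by (force simp: rot_def)
  qed
qed

lemma card_rot: "card (rot p x) = card (x :: (nat \<times> nat) set)"
  unfolding rot_def by (rule card_image) (auto simp: inj_on_def dest: injD[OF inj_cyc])

lemma low_rot: "low (rot p x) \<longleftrightarrow> low x"
  by (simp add: low_def types_rot card_rot)

lemma carrier_set_rot: "carrier_set (rot p x) = rot p (carrier_set x)"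
  by (auto simp: carrier_set_def low_rot types_rot hues_rot mixed_rot)

text \<open>A colour seen with all \<open>p\<close> signs yields one set of that colour in each of
  the \<open>p\<close> disjoint sign classes, against \<open>no_mono\<close>.\<close>

lemma slice_hues_neq:
  assumes "x \<in> signed_sets p n" shows "slice (hues x) j \<noteq> {..<p}"
proof
  assume eq: "slice (hues x) j = {..<p}"
  have "\<exists>A. A \<subseteq> cls x i \<and> card A = k \<and> inj_on b A \<and> c A = j" if "i < p" for i
  proof -
    have "i \<in> slice (hues x) j" using eq that by simp
    then show ?thesis by (auto simp: slice_def hues_def)
  qed
  then obtain G where G: "\<And>i. i < p \<Longrightarrow> G i \<subseteq> cls x i \<and> card (G i) = k \<and> inj_on b (G i) \<and> c (G i) = j"
    by metis
  have "cls x i \<inter> cls x i' = {}" if "i \<noteq> i'" for i i'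
    using signed_setD(4)[OF assms] that by (auto simp: cls_def)
  then have "disjoint_family_on G {..<p}"
    unfolding disjoint_family_on_def using G by (meson lessThan_iff disjoint_iff subsetD)
  moreover have "cls x i \<subseteq> {..<n}" for i
    using signed_setD(3)[OF assms] by (auto simp: cls_def)
  ultimately have "mono_family p k b c {..<n} G j"
    unfolding mono_family_def using G by (meson subset_trans)
  then show False using no_mono by blast
qed

lemma hues_subset:
  assumes "x \<in> signed_sets p n" shows "hues x \<subseteq> {..<t} \<times> {..<p}"
proof
  fix z assume "z \<in> hues x"
  then obtain A i where A: "z = (c A, i)" "A \<subseteq> cls x i" "card A = k" "inj_on b A"
    by (auto simp: hues_def)
  have "A \<noteq> {}" using A(3) k by auto
  then have "i < p" using A(2) signed_setD(3)[OF assms] by (auto simp: cls_def)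
  moreover have "A \<subseteq> {..<n}" using A(2) signed_setD(3)[OF assms] by (auto simp: cls_def)
  ultimately show "z \<in> {..<t} \<times> {..<p}" using A colour by auto
qed

lemma finite_hues: "x \<in> signed_sets p n \<Longrightarrow> finite (hues x)"
  using hues_subset by (rule finite_subset) auto

lemma card_hues:
  assumes "x \<in> signed_sets p n" shows "card (hues x) \<le> (p - 1) * t"
proof -
  have sub: "slice (hues x) j \<subset> {..<p}" for j
    using slice_hues_neq[OF assms, of j] hues_subset[OF assms] by (auto simp: slice_def)
  have "hues x = Sigma {..<t} (slice (hues x))"
    using hues_subset[OF assms] by (auto simp: slice_def)
  then have "card (hues x) = (\<Sum>j<t. card (slice (hues x) j))"
    using card_SigmaI[of "{..<t}" "slice (hues x)"] sub finite_subset[OF psubset_imp_subset[OF sub]] by simp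
  also have "\<dots> \<le> (\<Sum>j<t. p - 1)"
  proof (rule sum_mono)
    fix j show "card (slice (hues x) j) \<le> p - 1"
      using psubset_card_mono[OF _ sub[of j]] by simp
  qed
  finally show ?thesis by (simp add: mult.commute)
qed

text \<open>By pigeonhole, more than \<open>p * (k - 1)\<close> types force some sign class to meet
  \<open>k\<close> blocks; one representative from each gives a transversal
  \<open>k\<close>-set.\<close>

lemma hues_nonempty:
  assumes x: "x \<in> signed_sets p n" and "\<not> low x" shows "hues x \<noteq> {}"
proof -
  have "types x = (\<Union>i<p. (b ` cls x i) \<times> {i})"
    using signed_setD(3)[OF x] by (force simp: types_def cls_def)
  then have "card (types x) \<le> (\<Sum>i<p. card ((b ` cls x i) \<times> {i}))"
    using card_UN_le[of "{..<p}" "\<lambda>i. (b ` cls x i) \<times> {i}"] by simp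
  also have "\<dots> = (\<Sum>i<p. card (b ` cls x i))" by (simp add: card_cartesian_product)
  finally have "p * (k - 1) < (\<Sum>i<p. card (b ` cls x i))"
    using assms(2) by (simp add: low_def)
  then have "\<exists>i<p. k - 1 < card (b ` cls x i)"
    using sum_bounded_above[of "{..<p}" "\<lambda>i. card (b ` cls x i)" "k - 1"] by (force simp: not_less)
  then obtain i where i: "i < p" "k \<le> card (b ` cls x i)" by auto
  then obtain B where B: "B \<subseteq> b ` cls x i" "card B = k" by (meson obtain_subset_with_card_n)
  then obtain A where A: "A \<subseteq> cls x i" "inj_on b A" "B = b ` A" by (meson subset_image_inj)
  then have "card A = k" using B(2) by (simp add: card_image)
  then have "(c A, i) \<in> hues x" using A by (auto simp: hues_def)
  then show ?thesis by auto
qed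

text \<open>This makes \<open>set_sign_rot\<close> applicable. When \<open>x\<close> is its own
  carrier, its nonempty slices are singletons, hence proper since \<open>p\<close> is at least
  2.\<close>

lemma carrier_set_mixed:
  assumes x: "x \<in> signed_sets p n"
  shows "carrier_set x \<subseteq> UNIV \<times> {..<p} \<and> (\<exists>j. mixed p (carrier_set x) j)"
proof (cases "low x")
  case False
  obtain j i where "(j, i) \<in> hues x" using hues_nonempty[OF x False] by auto
  then have "mixed p (hues x) j" using slice_hues_neq[OF x] by (auto simp: mixed_def slice_def)
  then show ?thesis using False hues_subset[OF x] by (auto simp: carrier_set_def)
next
  case True
  obtain v i where vi: "(v, i) \<in> x" using signed_setD(1)[OF x] by auto
  then have "slice x v = {i}" using signed_setD(4)[OF x] by (auto simp: slice_def)
  moreover have "card {i} \<noteq> card {..<p}" using p_pos by simp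
  then have "{i} \<noteq> {..<p}" by metis
  ultimately have "mixed p x v" by (simp add: mixed_def)
  moreover have "x \<subseteq> UNIV \<times> {..<p}" using signed_setD(3)[OF x] by auto
  moreover have "types x \<subseteq> UNIV \<times> {..<p}" using signed_setD(3)[OF x] by (auto simp: types_def)
  ultimately show ?thesis using True by (auto simp: carrier_set_def)
qed

text \<open>A block met by \<open>x\<close> is met with all \<open>p\<close> signs, hence in
  \<open>p\<close> distinct points. It has at most \<open>p\<close> points, so \<open>x\<close>
  already contains all of them and \<open>y\<close> can add nothing.\<close>

lemma full_types_maximal:
  assumes x: "x \<in> signed_sets p n" and y: "y \<in> signed_sets p n"
    and "x \<subseteq> y" and eq: "types x = types y" and full: "\<And>j. \<not> mixed p (types x) j"
  shows "x = y"
proof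
  show "y \<subseteq> x"
  proof
    fix z assume z: "z \<in> y"
    obtain v i where vi: "z = (v, i)" by (cases z)
    let ?X = "{w. (\<exists>i. (w, i) \<in> x) \<and> b w = b v}"
    have "i \<in> slice (types x) (b v)" unfolding eq using z vi by (force simp: slice_def types_def)
    then have "slice (types x) (b v) = {..<p}" using full[of "b v"] by (auto simp: mixed_def)
    then have "\<exists>w. (w, j) \<in> x \<and> b w = b v" if "j < p" for j
    proof -
      have "j \<in> slice (types x) (b v)"
        using that \<open>slice (types x) (b v) = {..<p}\<close> by simp
      then show ?thesis by (auto simp: slice_def types_def)
    qed
    then obtain g where g: "\<And>j. j < p \<Longrightarrow> (g j, j) \<in> x \<and> b (g j) = b v" by metis
    have "inj_on g {..<p}" by (rule inj_onI) (metis g lessThan_iff signed_setD(4)[OF x])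
    then have "card (g ` {..<p}) = p" by (simp add: card_image)
    moreover have "g ` {..<p} \<subseteq> ?X" using g by auto
    moreover have sub: "?X \<subseteq> {w \<in> {..<n}. b w = b v}" using signed_setD(3)[OF x] by auto
    moreover have "finite {w \<in> {..<n}. b w = b v}" by simp
    moreover have "card ?X \<ge> p"
      using card_mono[OF finite_subset[OF sub] \<open>g ` {..<p} \<subseteq> ?X\<close>] \<open>card (g ` {..<p}) = p\<close> by simp
    ultimately have "?X = {w \<in> {..<n}. b w = b v}"
      using block[of "b v"] by (intro card_seteq) auto
    moreover have "v < n" using signed_setD(3)[OF y] z vi by auto
    ultimately obtain i' where "(v, i') \<in> x" by auto
    then show "z \<in> x" using assms(3) z vi signed_setD(4)[OF y] by blast
  qed
qed (rule assms(3))

text \<open>Growing \<open>x\<close> can only end the low phase, and then the level jumps because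
  \<open>hues y\<close> is nonempty. Within a phase, an unchanged level means unchanged types or
  hues, hence equal carriers and signs, or \<open>x = y\<close> by
  \<open>full_types_maximal\<close>.\<close>

lemma level_less:
  assumes x: "x \<in> signed_sets p n" and y: "y \<in> signed_sets p n" and "x \<subset> y"
    and sign: "set_sign p (carrier_set x) \<noteq> set_sign p (carrier_set y)"
  shows "level x < level y"
proof -
  have fin: "finite (types y)" using signed_setD(2)[OF y] by (simp add: types_def)
  have sub: "types x \<subseteq> types y" "hues x \<subseteq> hues y"
    using assms(3) by (intro types_mono hues_mono; auto)+
  have lowI: "low x" if "low y"
    using card_mono[OF fin sub(1)] that by (simp add: low_def)
  consider "low y" | "low x" "\<not> low y" | "\<not> low x" "\<not> low y" using lowI by blast
  then show ?thesis
  proof cases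
    case 1
    have "types x \<noteq> types y"
    proof
      assume eq: "types x = types y"
      then have "\<And>j. \<not> mixed p (types x) j"
        using sign 1 lowI by (auto simp: carrier_set_def split: if_splits)
      then show False using full_types_maximal[OF x y _ eq] assms(3) by auto
    qed
    then show ?thesis using 1 lowI sub(1) psubset_card_mono[OF fin, of "types x"]
      by (simp add: level_def psubset_eq)
  next
    case 2
    have "card (hues y) > 0"
      using hues_nonempty[OF y 2(2)] finite_hues[OF y] by (simp add: card_gt_0_iff)
    then show ?thesis using 2 by (simp add: level_def low_def)
  next
    case 3
    then have "hues x \<noteq> hues y" using sign by (auto simp: carrier_set_def)
    then show ?thesis using 3 sub(2) psubset_card_mono[OF finite_hues[OF y], of "hues x"]
      by (simp add: level_def psubset_eq)
  qed
qed

lemma level_pos: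
  assumes x: "x \<in> signed_sets p n" shows "level x > 0"
  using hues_nonempty[OF x] finite_hues[OF x] signed_setD(1,2)[OF x]
  by (auto simp: level_def types_def card_gt_0_iff)

lemma level_le:
  assumes x: "x \<in> signed_sets p n" shows "level x \<le> p * (k - 1) + (p - 1) * t"
  using card_hues[OF x] by (simp add: level_def low_def)

lemma card_bound: "n \<le> p * (k - 1) + (p - 1) * t"
proof (cases n)
  case (Suc m)
  define s where "s x = set_sign p (carrier_set x)" for x
  have "s x < p \<and> s (rot p x) = Suc (s x) mod p" if "x \<in> signed_sets p (Suc m)" for x
    unfolding s_def carrier_set_rot using carrier_set_mixed[of x] that Suc
    by (intro set_sign_rot p) auto
  then obtain l where l: "l \<in> flags p n" "distinct_adj (map s l)"
    using distinct_adj_flag[OF p_pos(2), of m s] Suc by auto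
  have len: "length l = n" and sorted: "sorted_wrt (\<subset>) l" and mem: "\<And>i. i < n \<Longrightarrow> l ! i \<in> signed_sets p n"
    using l(1) by (auto simp: flags_def)
  \<comment> \<open>The level starts positive and grows at each step of the flag; the last index is
    \<open>n - 1\<close>.\<close>
  have "i < level (l ! i)" if "i < n" for i
    using that
  proof (induction i)
    case 0
    then show ?case using level_pos mem by simp
  next
    case (Suc i)
    have "l ! i \<subset> l ! Suc i" using sorted Suc.prems len by (simp add: sorted_wrt_iff_nth_less)
    moreover have "s (l ! i) \<noteq> s (l ! Suc i)"
      using l(2) Suc.prems len by (simp add: distinct_adj_conv_nth)
    ultimately have "level (l ! i) < level (l ! Suc i)"
      using Suc.prems by (intro level_less mem) (auto simp: s_def)
    then show ?case using Suc by simp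
  qed
  then have "m < level (l ! m)" using Suc by simp
  then show ?thesis using level_le[OF mem, of m] Suc by simp
qed simp

end


lemma forces_mono_prime:
  assumes p: "prime p" shows "forces_mono p"
  unfolding forces_mono_def
proof (intro allI impI, rule ccontr)
  fix V :: "nat set" and k t :: nat and b :: "nat \<Rightarrow> nat" and c :: "nat set \<Rightarrow> nat"
  assume fin: "finite V" and k: "1 \<le> k" and block: "\<forall>j. card {v \<in> V. b v = j} \<le> p"
    and col: "\<forall>A. A \<subseteq> V \<longrightarrow> card A = k \<longrightarrow> inj_on b A \<longrightarrow> c A < t"
    and large: "p * (k - 1) + (p - 1) * t < card V"
    and none: "\<nexists>G col. mono_family p k b c V G col"
  obtain h where h: "bij_betw h {..<card V} V"
    using ex_bij_betw_nat_finite[OF fin] by (auto simp: lessThan_atLeast0)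
  have inj: "inj_on h {..<card V}" and im: "h ` {..<card V} = V"
    using h by (auto simp: bij_betw_def)
  have image: "h ` A \<subseteq> V \<and> card (h ` A) = card A \<and> (inj_on (b \<circ> h) A \<longleftrightarrow> inj_on b (h ` A))"
    if "A \<subseteq> {..<card V}" for A
  proof -
    have "inj_on h A" using inj_on_subset[OF inj that] .
    then show ?thesis using that im by (auto simp: card_image comp_inj_on_iff)
  qed
  have "prime_colouring p k t (card V) (b \<circ> h) (\<lambda>A. c (h ` A))"
  proof
    fix j
    have "h ` {v \<in> {..<card V}. (b \<circ> h) v = j} \<subseteq> {v \<in> V. b v = j}" using im by auto
    then have "card (h ` {v \<in> {..<card V}. (b \<circ> h) v = j}) \<le> card {v \<in> V. b v = j}"
      using fin by (intro card_mono) auto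
    moreover have "card (h ` {v \<in> {..<card V}. (b \<circ> h) v = j}) = card {v \<in> {..<card V}. (b \<circ> h) v = j}"
      by (rule card_image) (rule inj_on_subset[OF inj], auto)
    ultimately show "card {v \<in> {..<card V}. (b \<circ> h) v = j} \<le> p"
      using block[rule_format, of j] by linarith
  next
    fix G j
    show "\<not> mono_family p k (b \<circ> h) (\<lambda>A. c (h ` A)) {..<card V} G j"
    proof
      assume G: "mono_family p k (b \<circ> h) (\<lambda>A. c (h ` A)) {..<card V} G j"
      then have sub: "G i \<subseteq> {..<card V}" if "i < p" for i
        using that by (auto simp: mono_family_def)
      have "disjoint_family_on (\<lambda>i. h ` G i) {..<p}"
        unfolding disjoint_family_on_def
      proof (intro ballI impI)
        fix i i' assume i: "i \<in> {..<p}" "i' \<in> {..<p}" "i \<noteq> i'"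
        then have "G i \<inter> G i' = {}" "G i \<subseteq> {..<card V}" "G i' \<subseteq> {..<card V}"
          using G sub by (simp_all add: mono_family_def disjoint_family_on_def)
        then show "h ` G i \<inter> h ` G i' = {}"
          using inj_on_image_Int[OF inj, of "G i" "G i'"] by simp
      qed
      then have "mono_family p k b c V (\<lambda>i. h ` G i) j"
        using G image[OF sub] unfolding mono_family_def by simp
      then show False using none by blast
    qed
  next
    fix A assume "A \<subseteq> {..<card V}" "card A = k" "inj_on (b \<circ> h) A"
    then show "c (h ` A) < t" using image[of A] col by simp
  qed (fact p, fact k)
  then have "card V \<le> p * (k - 1) + (p - 1) * t" by (rule prime_colouring.card_bound)
  then show False using large by simp
qed

section \<open>Composite uniformity by refinement of the blocks\<close>

lemma div_mod_inject: "m div d = n div d \<Longrightarrow> m mod d = n mod d \<Longrightarrow> m = (n :: nat)"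
  by (metis div_mult_mod_eq)

text \<open>Each block is split by the rank of its points modulo \<open>r1\<close>. Ranks are below
  \<open>r1 * r2\<close>, so a residue occurs at most \<open>r2\<close> times, and a transversal of
  the parts takes at most one point per residue.\<close>

lemma exists_refinement:
  fixes V :: "nat set" and b :: "nat \<Rightarrow> nat"
  assumes "finite V" and "r1 > 0" and "\<And>j. card {v \<in> V. b v = j} \<le> r1 * r2"
  shows "\<exists>b' :: nat \<Rightarrow> nat. (\<forall>j. card {v \<in> V. b' v = j} \<le> r2) \<and>
    (\<forall>W j. W \<subseteq> V \<longrightarrow> inj_on b' W \<longrightarrow> card {v \<in> W. b v = j} \<le> r1)"
proof -
  define rank where "rank v = card {w \<in> V. b w = b v \<and> w < v}" for v
  define b' where "b' v = b v * r1 + rank v mod r1" for v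
  have b'D: "b v = b w \<and> rank v mod r1 = rank w mod r1" if "b' v = b' w" for v w
  proof -
    have "b' x div r1 = b x \<and> b' x mod r1 = rank x mod r1" for x
      using assms(2) by (simp add: b'_def)
    from this[of v] this[of w] that show ?thesis by simp
  qed
  have rank_less: "rank v < rank w" if "v \<in> V" "w \<in> V" "b v = b w" "v < w" for v w
    unfolding rank_def using that assms(1) by (intro psubset_card_mono) auto
  have rank_inj: "v = w" if "v \<in> V" "w \<in> V" "b v = b w" "rank v = rank w" for v w
    using rank_less[of v w] rank_less[of w v] that by (cases v w rule: linorder_cases) auto
  have rank_bound: "rank v < r1 * r2" if "v \<in> V" for v
  proof -
    have "rank v < card {w \<in> V. b w = b v}"
      unfolding rank_def using that assms(1) by (intro psubset_card_mono) auto
    then show ?thesis using assms(3)[of "b v"] by simp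
  qed
  have "card {v \<in> V. b' v = j} \<le> r2" for j
  proof -
    have "inj_on (\<lambda>v. rank v div r1) {v \<in> V. b' v = j}"
    proof (rule inj_onI)
      fix v w assume vw: "v \<in> {v \<in> V. b' v = j}" "w \<in> {v \<in> V. b' v = j}" "rank v div r1 = rank w div r1"
      then have bvw: "b v = b w" "rank v mod r1 = rank w mod r1" using b'D[of v w] by auto
      have "rank v = rank w" by (rule div_mod_inject[OF vw(3) bvw(2)])
      then show "v = w" using rank_inj vw bvw(1) by auto
    qed
    moreover have "(\<lambda>v. rank v div r1) ` {v \<in> V. b' v = j} \<subseteq> {..<r2}"
      using rank_bound by (auto intro!: less_mult_imp_div_less simp: mult.commute)
    ultimately show ?thesis using card_inj_on_le[OF _ _ finite_lessThan] by fastforce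
  qed
  moreover have "card {v \<in> W. b v = j} \<le> r1" if "W \<subseteq> V" "inj_on b' W" for W j
  proof -
    have "inj_on (\<lambda>v. rank v mod r1) {v \<in> W. b v = j}"
    proof (rule inj_onI)
      fix v w assume vw: "v \<in> {v \<in> W. b v = j}" "w \<in> {v \<in> W. b v = j}" "rank v mod r1 = rank w mod r1"
      then have "b' v = b' w" by (simp add: b'_def)
      then show "v = w" using inj_onD[OF that(2)] vw by simp
    qed
    moreover have "(\<lambda>v. rank v mod r1) ` {v \<in> W. b v = j} \<subseteq> {..<r1}" using assms(2) by auto
    ultimately show ?thesis using card_inj_on_le[OF _ _ finite_lessThan] by fastforce
  qed
  ultimately show ?thesis by (intro exI[of _ b']) simp
qed

lemma forces_mono_mult:
  assumes r1: "forces_mono r1" "r1 > 0" and r2: "forces_mono r2" "r2 > 0"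
  shows "forces_mono (r1 * r2)"
  unfolding forces_mono_def
proof (intro allI impI)
  fix V :: "nat set" and k t :: nat and b :: "nat \<Rightarrow> nat" and c :: "nat set \<Rightarrow> nat"
  assume fin: "finite V" and k: "1 \<le> k" and block: "\<forall>j. card {v \<in> V. b v = j} \<le> r1 * r2"
    and col: "\<forall>A. A \<subseteq> V \<longrightarrow> card A = k \<longrightarrow> inj_on b A \<longrightarrow> c A < t"
    and large: "r1 * r2 * (k - 1) + (r1 * r2 - 1) * t < card V"
  obtain b' :: "nat \<Rightarrow> nat" where "(\<forall>j. card {v \<in> V. b' v = j} \<le> r2) \<and>
      (\<forall>W j. W \<subseteq> V \<longrightarrow> inj_on b' W \<longrightarrow> card {v \<in> W. b v = j} \<le> r1)"
    using exists_refinement[OF fin r1(2) block[rule_format]] by (rule exE)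
  then have b': "\<And>j. card {v \<in> V. b' v = j} \<le> r2"
    "\<And>W j. W \<subseteq> V \<Longrightarrow> inj_on b' W \<Longrightarrow> card {v \<in> W. b v = j} \<le> r1"
    by simp_all
  \<comment> \<open>The least size above the threshold for \<open>r1\<close>; with it the two
    thresholds compose exactly to the one for \<open>r1 * r2\<close>.\<close>
  define k' where "k' = r1 * (k - 1) + (r1 - 1) * t + 1"
  have ex: "\<exists>G col. mono_family r1 k b c W G col" if W: "W \<subseteq> V" "card W = k'" "inj_on b' W" for W
  proof -
    have "finite W" using W(1) fin by (rule finite_subset)
    moreover have "r1 * (k - 1) + (r1 - 1) * t < card W" using W(2) by (simp add: k'_def)
    ultimately show ?thesis
      using r1(1)[unfolded forces_mono_def, rule_format, of W k b c t] k b'(2)[OF W(1,3)] col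
        subset_trans[OF _ W(1)] by simp
  qed
  define G where "G W = (SOME G. \<exists>col. mono_family r1 k b c W G col)" for W
  define c' where "c' W = (SOME col. mono_family r1 k b c W (G W) col)" for W
  have G: "mono_family r1 k b c W (G W) (c' W)" if "W \<subseteq> V" "card W = k'" "inj_on b' W" for W
  proof -
    have "\<exists>col. mono_family r1 k b c W (G W) col"
      using someI_ex[OF ex[OF that]] unfolding G_def .
    then show ?thesis unfolding c'_def by (rule someI_ex)
  qed
  have c'_less: "c' W < t" if "W \<subseteq> V" "card W = k'" "inj_on b' W" for W
  proof -
    have G0: "G W 0 \<subseteq> W" "card (G W 0) = k" "inj_on b (G W 0)" "c (G W 0) = c' W"
      using G[OF that] r1(2) by (simp_all add: mono_family_def)
    show ?thesis
      using col[rule_format, OF subset_trans[OF G0(1) that(1)] G0(2,3)] G0(4) by simp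
  qed
  have "r2 * (k' - 1) + (r2 - 1) * t < card V"
  proof -
    obtain q1 q2 k0 where "r1 = Suc q1" "r2 = Suc q2" "k = Suc k0"
      using gr0_implies_Suc[OF r1(2)] gr0_implies_Suc[OF r2(2)] gr0_implies_Suc[of k] k by auto
    then have "r2 * (k' - 1) + (r2 - 1) * t = r1 * r2 * (k - 1) + (r1 * r2 - 1) * t"
      by (simp add: k'_def algebra_simps)
    then show ?thesis using large by simp
  qed
  then obtain W j where W: "mono_family r2 k' b' c' V W j"
    using r2(1)[unfolded forces_mono_def, rule_format, of V k' b' c' t] fin b'(1) c'_less
    unfolding k'_def by simp blast
  have W': "W i \<subseteq> V" "card (W i) = k'" "inj_on b' (W i)" "c' (W i) = j" if "i < r2" for i
    using W that by (auto simp: mono_family_def)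
  have GW: "mono_family r1 k b c (W i) (G (W i)) j" if "i < r2" for i
    using G[OF W'(1-3)[OF that]] W'(4)[OF that] by simp
  \<comment> \<open>The quotient of \<open>i\<close> selects one of the \<open>r2\<close> sets
    \<open>W\<close>, the remainder one of the \<open>r1\<close> sets inside it.\<close>
  define F where "F i = G (W (i div r1)) (i mod r1)" for i
  have idx: "i div r1 < r2" "i mod r1 < r1" if "i < r1 * r2" for i
    using that r1(2) by (auto intro!: less_mult_imp_div_less simp: mult.commute)
  have F: "F i \<subseteq> W (i div r1) \<and> card (F i) = k \<and> inj_on b (F i) \<and> c (F i) = j" if "i < r1 * r2" for i
    using GW[OF idx(1)[OF that]] idx(2)[OF that] by (simp add: mono_family_def F_def)
  have "F i \<inter> F i' = {}" if i: "i < r1 * r2" "i' < r1 * r2" "i \<noteq> i'" for i i'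
  proof (cases "i div r1 = i' div r1")
    case True
    then have "i mod r1 \<noteq> i' mod r1" using i(3) div_mod_inject by blast
    then show ?thesis
      using GW[OF idx(1)[OF i(1)]] idx(2)[OF i(1)] idx(2)[OF i(2)] True
      by (simp add: mono_family_def F_def disjoint_family_on_def)
  next
    case False
    then have "W (i div r1) \<inter> W (i' div r1) = {}"
      using W idx(1)[OF i(1)] idx(1)[OF i(2)] by (auto simp: mono_family_def disjoint_family_on_def)
    then show ?thesis using F[OF i(1)] F[OF i(2)] by blast
  qed
  moreover have "F i \<subseteq> V" if "i < r1 * r2" for i
    using F[OF that] W'(1)[OF idx(1)[OF that]] by blast
  ultimately have "mono_family (r1 * r2) k b c V F j"
    using F unfolding mono_family_def disjoint_family_on_def by simp
  then show "\<exists>G col. mono_family (r1 * r2) k b c V G col" by blast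
qed

lemma forces_mono: "r \<ge> 2 \<Longrightarrow> forces_mono r"
proof (induction r rule: less_induct)
  case (less r)
  show ?case
  proof (cases "prime r")
    case True
    then show ?thesis by (rule forces_mono_prime)
  next
    case False
    then obtain m d where "r = m * d" "m < r" "d < r" "m \<ge> 2" "d \<ge> 2"
    proof -
      obtain m where m: "m dvd r" "m \<noteq> 1" "m \<noteq> r"
        using False less.prems by (auto simp: prime_nat_iff)
      then obtain d where d: "r = m * d" by (auto elim: dvdE)
      have "m \<noteq> 0" "d \<noteq> 0" "d \<noteq> 1" using d m less.prems by (auto intro: gr0I)
      then have "m \<ge> 2" "d \<ge> 2" using m by auto
      then show thesis using d that[of m d] by auto
    qed
    then show ?thesis using less.IH forces_mono_mult by simp
  qed
qed

section \<open>The lower bound for the Kneser hypergraph\<close>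

lemma kg_lower:
  assumes r: "r \<ge> 2" and k: "k \<ge> 1" and P: "partition_on {1..n} P"
    and small: "\<forall>B\<in>P. card B \<le> r"
    and f: "proper_colouring (kg_vertices n k P) (kg_edges r n k P) t f"
  shows "n \<le> r * (k - 1) + (r - 1) * t"
proof (rule ccontr)
  assume large: "\<not> ?thesis"
  have "finite P" using P by (rule finite_elements[rotated]) simp
  then obtain g :: "nat set \<Rightarrow> nat" where g: "inj_on g P" using finite_imp_inj_to_nat_seg by metis
  define b where "b v = g (THE B. B \<in> P \<and> v \<in> B)" for v
  have b: "b v = g B" if "B \<in> P" "v \<in> B" for v B
  proof -
    have "(THE B. B \<in> P \<and> v \<in> B) = B"
      using that P by (intro the_equality) (auto simp: partition_on_def dest: disjointD)
    then show ?thesis by (simp add: b_def)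
  qed
  have ex: "\<exists>B\<in>P. v \<in> B" if "v \<in> {1..n}" for v
    using P that by (auto simp: partition_on_def)
  have block: "card {v \<in> {1..n}. b v = j} \<le> r" for j
  proof (cases "\<exists>B\<in>P. g B = j")
    case True
    then obtain B where B: "B \<in> P" "g B = j" by auto
    have "{v \<in> {1..n}. b v = j} \<subseteq> B"
    proof
      fix v assume v: "v \<in> {v \<in> {1..n}. b v = j}"
      then obtain B' where "B' \<in> P" "v \<in> B'" using ex by auto
      then have "g B = g B'" using b[of B' v] v B(2) by simp
      then have "B = B'" using inj_onD[OF g] B(1) \<open>B' \<in> P\<close> by blast
      then show "v \<in> B" using \<open>v \<in> B'\<close> by simp
    qed
    moreover have "finite B" using B(1) P by (auto simp: partition_on_def intro: finite_subset)
    ultimately have "card {v \<in> {1..n}. b v = j} \<le> card B" by (intro card_mono)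
    then show ?thesis using small[rule_format, OF B(1)] by (rule order_trans)
  next
    case False
    then have "{v \<in> {1..n}. b v = j} = {}" using ex b by fastforce
    then show ?thesis by (simp only: card.empty le0)
  qed
  have vertex: "A \<in> kg_vertices n k P" if A: "A \<subseteq> {1..n}" "card A = k" "inj_on b A" for A
  proof -
    have "card (A \<inter> B) \<le> 1" if B: "B \<in> P" for B
    proof -
      have "finite (A \<inter> B)" using A(1) finite_subset by blast
      moreover have "v = w" if "v \<in> A \<inter> B" "w \<in> A \<inter> B" for v w
      proof (rule inj_onD[OF A(3)])
        show "b v = b w" using b[OF B, of v] b[OF B, of w] that by simp
      qed (use that in simp_all)
      ultimately show ?thesis by (simp add: card_le_Suc0_iff_eq)
    qed
    then show ?thesis using A by (simp add: kg_vertices_def)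
  qed
  have "\<exists>G col. mono_family r k b f {1..n} G col"
    using forces_mono[OF r, unfolded forces_mono_def, rule_format, of "{1..n}" k b f t] k block large
      f[unfolded proper_colouring_def] vertex by auto
  then obtain G col where G: "mono_family r k b f {1..n} G col" by auto
  have disj: "G i \<inter> G j = {}" if "i < r" "j < r" "i \<noteq> j" for i j
    using G that by (auto simp: mono_family_def disjoint_family_on_def)
  have Gi: "G i \<in> kg_vertices n k P \<and> f (G i) = col \<and> G i \<noteq> {}" if "i < r" for i
  proof -
    have "G i \<subseteq> {1..n}" "card (G i) = k" "inj_on b (G i)" "f (G i) = col"
      using G that by (simp_all add: mono_family_def)
    then show ?thesis using vertex[of "G i"] k by auto
  qed
  \<comment> \<open>Disjoint nonempty sets are distinct, so the family is an edge with exactly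
    \<open>r\<close> members.\<close>
  have "inj_on G {..<r}" by (rule inj_onI) (metis disj Gi Int_absorb lessThan_iff)
  then have "card (G ` {..<r}) = r" by (simp add: card_image)
  moreover have "\<forall>A\<in>G ` {..<r}. \<forall>A'\<in>G ` {..<r}. A \<noteq> A' \<longrightarrow> A \<inter> A' = {}"
    using disj by (metis imageE lessThan_iff)
  ultimately have "G ` {..<r} \<in> kg_edges r n k P"
    using Gi by (auto simp: kg_edges_def)
  moreover have "\<forall>A\<in>G ` {..<r}. f A = col" using Gi by auto
  ultimately show False using f by (auto simp: proper_colouring_def)
qed

section \<open>The upper bound by colouring with minima\<close>

lemma kg_upper:
  assumes r: "r \<ge> 2" and k: "k \<ge> 1" and t: "t \<ge> 1" and n: "n \<le> r * (k - 1) + (r - 1) * t"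
  shows "\<exists>f. proper_colouring (kg_vertices n k P) (kg_edges r n k P) t f"
proof -
  define f where "f A = min ((Min A - 1) div (r - 1)) (t - 1)" for A :: "nat set"
  have False if E: "E \<in> kg_edges r n k P" and mono: "\<And>A. A \<in> E \<Longrightarrow> f A = col" for E col
  proof -
    have cE: "card E = r" and disj: "\<And>A A'. A \<in> E \<Longrightarrow> A' \<in> E \<Longrightarrow> A \<noteq> A' \<Longrightarrow> A \<inter> A' = {}"
      and mem: "\<And>A. A \<in> E \<Longrightarrow> A \<subseteq> {1..n} \<and> card A = k"
      using E by (auto simp: kg_edges_def kg_vertices_def)
    have fE: "finite E" using cE r card.infinite by fastforce
    have fA: "finite A" if "A \<in> E" for A using mem[OF that] finite_subset by blast
    have Min: "Min A \<in> A" if "A \<in> E" for A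
      using fA[OF that] mem[OF that] k by (intro Min_in) auto
    have inj: "inj_on Min E" by (rule inj_onI) (metis Min disj disjoint_iff)
    show False
    proof (cases "col < t - 1")
      case True
      \<comment> \<open>A colour below the last leaves only \<open>r - 1\<close> possible minima for
        \<open>r\<close> disjoint sets.\<close>
      have "Min ` E \<subseteq> {col * (r - 1) + 1 ..< col * (r - 1) + 1 + (r - 1)}"
      proof
        fix m assume "m \<in> Min ` E"
        then obtain A where A: "A \<in> E" "m = Min A" by auto
        have "m \<ge> 1" using Min[OF A(1)] mem[OF A(1)] A(2) by auto
        moreover have "(m - 1) div (r - 1) = col" using mono[OF A(1)] True A(2) by (auto simp: f_def min_def split: if_splits)
        then have "col * (r - 1) \<le> m - 1" "m - 1 < (r - 1) + col * (r - 1)"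
          using r dividend_less_div_times[of "r - 1" "m - 1"] div_times_less_eq_dividend[of "m - 1" "r - 1"]
          by simp_all
        ultimately show "m \<in> {col * (r - 1) + 1 ..< col * (r - 1) + 1 + (r - 1)}" by auto
      qed
      from card_mono[OF _ this] have "card (Min ` E) \<le> r - 1" by simp
      then show False using card_image[OF inj] cE r by simp
    next
      case False
      define q where "q = (t - 1) * (r - 1)"
      have "\<Union>E \<subseteq> {q + 1..n}"
      proof
        fix v assume "v \<in> \<Union>E"
        then obtain A where A: "A \<in> E" "v \<in> A" by auto
        have "t - 1 \<le> (Min A - 1) div (r - 1)" using mono[OF A(1)] False by (auto simp: f_def)
        then have "q \<le> Min A - 1" unfolding q_def
          using order_trans[OF mult_le_mono1 div_times_less_eq_dividend] by blast
        moreover have "Min A \<ge> 1" using Min[OF A(1)] mem[OF A(1)] by auto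
        moreover have "Min A \<le> v" using fA A by simp
        ultimately show "v \<in> {q + 1..n}" using mem[OF A(1)] A(2) by auto
      qed
      from card_mono[OF _ this] have "card (\<Union>E) \<le> n - q" by simp
      moreover have "card (\<Union>E) = (\<Sum>A\<in>E. card A)"
        using fA disj by (intro card_Union_disjoint) (auto simp: pairwise_def disjnt_def)
      then have "card (\<Union>E) = r * k" using mem cE by simp
      \<comment> \<open>The bound on \<open>n\<close> leaves at most
        \<open>r * (k - 1) + (r - 1) = r * k - 1\<close> points above \<open>q\<close>.\<close>
      moreover have "n - q < r * k"
      proof -
        obtain t' k' r' where "t = Suc t'" "k = Suc k'" "r = Suc (Suc r')"
        proof
          show "t = Suc (t - 1)" "k = Suc (k - 1)" "r = Suc (Suc (r - 2))" using t k r by simp_all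
        qed
        then show ?thesis using n by (simp add: q_def algebra_simps)
      qed
      ultimately show False by simp
    qed
  qed
  moreover have "f A < t" for A using t by (auto simp: f_def min_def)
  ultimately have "proper_colouring (kg_vertices n k P) (kg_edges r n k P) t f"
    unfolding proper_colouring_def by blast
  then show ?thesis by blast
qed

theorem theorem1:
  fixes n k r :: nat and P :: "nat set set"
  assumes "r \<ge> 2" and "k \<ge> 1" and "n \<ge> r * k"
    and "partition_on {1..n} P"
    and "\<forall>B\<in>P. card B \<le> r"
  shows "int (chromatic_number (kg_vertices n k P) (kg_edges r n k P))
           = \<lceil>(real n - real r * (real k - 1)) / (real r - 1)\<rceil>"
proof -
  let ?V = "kg_vertices n k P" and ?E = "kg_edges r n k P"
  let ?x = "(real n - real r * (real k - 1)) / (real r - 1)"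
  have bound: "n \<le> r * (k - 1) + (r - 1) * t \<longleftrightarrow> ?x \<le> real t" for t
  proof -
    have "n \<le> r * (k - 1) + (r - 1) * t \<longleftrightarrow> real n \<le> real (r * (k - 1) + (r - 1) * t)"
      by (simp only: of_nat_le_iff)
    also have "\<dots> \<longleftrightarrow> ?x \<le> real t"
    proof -
      obtain r' k' where "r = Suc (Suc r')" "k = Suc k'"
      proof
        show "r = Suc (Suc (r - 2))" "k = Suc (k - 1)" using assms(1,2) by simp_all
      qed
      then show ?thesis by (simp add: divide_le_eq algebra_simps)
    qed
    finally show ?thesis .
  qed
  \<comment> \<open>The numerator is at least \<open>r\<close>, so the ceiling is positive and
    \<open>kg_upper\<close> gets its \<open>t \<ge> 1\<close>.\<close>
  have "real n \<ge> real r * real k" using assms(3) by (metis of_nat_le_iff of_nat_mult)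
  then have "?x > 0" using assms(1) by (intro divide_pos_pos) (auto simp: algebra_simps)
  define t where "t = nat \<lceil>?x\<rceil>"
  have t: "int t = \<lceil>?x\<rceil>" using \<open>?x > 0\<close> by (simp add: t_def)
  then have "?x \<le> real t" by linarith
  moreover have "t \<ge> 1" using t \<open>?x > 0\<close> by linarith
  ultimately have "\<exists>f. proper_colouring ?V ?E t f"
    using bound by (intro kg_upper assms(1,2)) auto
  moreover have "t \<le> t'" if "\<exists>f. proper_colouring ?V ?E t' f" for t'
  proof -
    have "?x \<le> real t'" using that kg_lower[OF assms(1,2,4,5)] bound by blast
    then have "\<lceil>?x\<rceil> \<le> int t'" by linarith
    then show ?thesis using t by simp
  qed
  ultimately have "chromatic_number ?V ?E = t"
    unfolding chromatic_number_def by (intro Least_equality)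
  then show ?thesis using t by simp
qed

end
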